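(* Suppose that $M$ is a numerical monoid and that $S$ is a numerical set with $A(S)=M$. Then $M\subseteq S\subseteq M^*$.
   Context: A numerical set is a cofinite subset $S\subseteq\mathbb N=\{0,1,2,\dots\}$ containing $0$; its Frobenius number is $g=\max(\mathbb Z-S)$. A numerical monoid is a numerical set closed under addition. The atom monoid of $S$ is $A(S)=\{n\in\mathbb Z: n+S\subseteq S\}$; it is a numerical monoid with the same Frobenius number as $S$. The dual of a numerical set $S$ with Frobenius number $g$ is $S^*=\{n\in\mathbb Z: g-n\notin S\}$. *)

theory Defs
  imports Main
begin

text \<open>
  Since atom monoids and duals are carved out of the integers, numerical sets are
  represented as sets of integers; \<open>\<nat>\<close> below is the set of non-negative integers.
\<close>

definition numerical_set :: "int set \<Rightarrow> bool" where
  "numerical_set S \<longleftrightarrow> S \<subseteq> \<nat> \<and> 0 \<in> S \<and> finite (\<nat> - S)"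

definition numerical_monoid :: "int set \<Rightarrow> bool" where
  "numerical_monoid M \<longleftrightarrow> numerical_set M \<and> (\<forall>a\<in>M. \<forall>b\<in>M. a + b \<in> M)"

text \<open>
  The maximum of \<open>\<int> - S\<close>. That set is infinite, so \<^const>\<open>Max\<close> is not
  applicable. For \<open>S = \<nat>\<close> the value is \<open>-1\<close>.
\<close>

definition frobenius :: "int set \<Rightarrow> int" where
  "frobenius S = (GREATEST n. n \<notin> S)"

definition atom_monoid :: "int set \<Rightarrow> int set" where
  "atom_monoid S = {n. (+) n ` S \<subseteq> S}"

definition dual :: "int set \<Rightarrow> int set" where
  "dual S = {n. frobenius S - n \<notin> S}"

lemma frobenius_is_max:
  assumes "numerical_set S"
  shows "frobenius S \<notin> S" and "n \<notin> S \<Longrightarrow> n \<le> frobenius S"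
proof -
  let ?F = "insert (-1) (\<nat> - S)"
  have fin: "finite ?F" and sub: "S \<subseteq> \<nat>"
    using assms by (auto simp: numerical_set_def)
  have neg: "(-1::int) \<notin> \<nat>"
    by (simp add: Nats_altdef1)
  have notin: "Max ?F \<notin> S"
    using Max_in[OF fin] sub neg by auto
  have upper: "m \<le> Max ?F" if "m \<notin> S" for m
  proof (cases "m \<in> \<nat>")
    case True
    then show ?thesis using that fin by (intro Max_ge) auto
  next
    case False
    have "m < 0"
    proof (rule ccontr)
      assume "\<not> m < 0"
      then have "m = of_nat (nat m)" by simp
      then have "m \<in> \<nat>" using of_nat_in_Nats by metis
      with False show False by contradiction
    qed
    then have "m \<le> -1" by simp
    also have "-1 \<le> Max ?F" using fin by (intro Max_ge) auto
    finally show ?thesis .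
  qed
  have "frobenius S = Max ?F"
    unfolding frobenius_def using notin upper by (rule Greatest_equality)
  then show "frobenius S \<notin> S" and "n \<notin> S \<Longrightarrow> n \<le> frobenius S"
    using notin upper by auto
qed

end

theory Submission
  imports Defs
begin

text \<open>Since 0 lies in S, n + S \<subseteq> S forces n into S; this gives the first inclusion.
  For the second, let g be the Frobenius number of S. If s is in S and g - s were in A(S), then g =
  (g - s) + s would be in S, which is absurd. As \<open>dual M\<close> is formed with the Frobenius
  number of M, \<open>frobenius_atom_monoid\<close> is needed to identify that number with
  g.\<close>

lemma atom_monoid_subset:
  assumes "numerical_set S"
  shows "atom_monoid S \<subseteq> S"
  using assms by (force simp: atom_monoid_def numerical_set_def)

text \<open>A gap of S is a gap of the smaller set A(S), so g stays missing. Conversely, a missing n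
  has a witness s \<ge> 0 in S with n + s a gap of S, whence n \<le> n + s \<le> g.\<close>

lemma frobenius_atom_monoid:
  assumes "numerical_set S"
  shows "frobenius (atom_monoid S) = frobenius S"
  unfolding frobenius_def[of "atom_monoid S"]
proof (rule Greatest_equality)
  show "frobenius S \<notin> atom_monoid S"
    using atom_monoid_subset[OF assms] frobenius_is_max(1)[OF assms] by blast
next
  fix n
  assume "n \<notin> atom_monoid S"
  then obtain s where s: "s \<in> S" "n + s \<notin> S"
    by (auto simp: atom_monoid_def)
  have "0 \<le> s"
    using s(1) assms by (auto simp: numerical_set_def Nats_altdef1)
  then show "n \<le> frobenius S"
    using frobenius_is_max(2)[OF assms s(2)] by simp
qed

theorem proposition1:
  fixes M S :: "int set"
  assumes "numerical_monoid M"
    and "numerical_set S"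
    and "atom_monoid S = M"
  shows "M \<subseteq> S \<and> S \<subseteq> dual M"
proof
  show "M \<subseteq> S"
    using atom_monoid_subset assms(2,3) by blast
  show "S \<subseteq> dual M"
  proof
    fix s
    assume s: "s \<in> S"
    have "frobenius S - s \<notin> M"
    proof
      assume "frobenius S - s \<in> M"
      then have "(frobenius S - s) + s \<in> S"
        using s assms(3) unfolding atom_monoid_def by blast
      then show False
        using frobenius_is_max(1)[OF assms(2)] by simp
    qed
    then show "s \<in> dual M"
      using frobenius_atom_monoid[OF assms(2)] assms(3) by (simp add: dual_def)
  qed
qed

end
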